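(* Let $X$ and $Y$ be perfect Polish spaces. If $A$ is countably perfectly meager in $X$ and $B$ is countably perfectly meager in $Y$, then $A\times B$ is countably perfectly meager in $X\times Y$.
   Context: A perfect Polish space is a separable completely metrizable space with no isolated points; a perfect set is a non-empty closed set with no isolated points. A subset $A$ of a perfect Polish space $X$ is countably perfectly meager in $X$ if for every sequence $\{P_n : n\in\mathbb{N}\}$ of perfect subsets of $X$ there exists an $F_\sigma$-set $F$ in $X$ such that $A\subseteq F$ and $F\cap P_n$ is meager in $P_n$ for each $n$. *)

theory Defs
  imports "HOL-Analysis.Analysis"
begin

definition no_isolated_points :: "'a topology \<Rightarrow> bool" where
  "no_isolated_points X \<longleftrightarrow> (\<forall>x \<in> topspace X. \<not> openin X {x})"

(* The empty space is not excluded here; perfect sets, in contrast, are non-empty. *)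
definition perfect_Polish_space :: "'a topology \<Rightarrow> bool" where
  "perfect_Polish_space X \<longleftrightarrow>
     separable_space X \<and> completely_metrizable_space X \<and> no_isolated_points X"

definition perfect_in :: "'a topology \<Rightarrow> 'a set \<Rightarrow> bool" where
  "perfect_in X P \<longleftrightarrow>
     P \<noteq> {} \<and> closedin X P \<and> no_isolated_points (subtopology X P)"

definition nowhere_dense_in :: "'a topology \<Rightarrow> 'a set \<Rightarrow> bool" where
  "nowhere_dense_in X S \<longleftrightarrow> S \<subseteq> topspace X \<and> X interior_of (X closure_of S) = {}"

definition meager_in :: "'a topology \<Rightarrow> 'a set \<Rightarrow> bool" where
  "meager_in X = (countable union_of nowhere_dense_in X)"

definition countably_perfectly_meager_in :: "'a topology \<Rightarrow> 'a set \<Rightarrow> bool" where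
  "countably_perfectly_meager_in X A \<longleftrightarrow>
     A \<subseteq> topspace X \<and>
     (\<forall>P :: nat \<Rightarrow> 'a set. (\<forall>n. perfect_in X (P n)) \<longrightarrow>
        (\<exists>F. fsigma_in X F \<and> A \<subseteq> F \<and>
             (\<forall>n. meager_in (subtopology X (P n)) (F \<inter> P n))))"

end

theory Submission
  imports Defs
begin

text \<open>
  The proof reduces perfect subsets of the product to perfect subsets of the factors by projecting.
  Let \<open>P\<close> be perfect in the product and let \<open>U \<times> V\<close> be a basic open rectangle meeting \<open>P\<close>. If the
  closure of the first projection of \<open>P \<inter> (U \<times> V)\<close> is not perfect, it has an isolated point \<open>x\<close>.
  Shrinking \<open>U\<close> around \<open>x\<close> leaves a non-empty relatively open piece of \<open>P\<close> inside the vertical line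
  over \<open>x\<close>; as \<open>P\<close> has no isolated points, the second projection of this piece has none either, so
  its closure is perfect. Thus the rectangles for which one of the two projections has perfect
  closure suffice (\<open>perfect_projection_of_smaller_rectangle\<close>).

  There are only countably many such closures, for all basic rectangles and all members of the
  given sequence of perfect sets together. The hypotheses on \<open>A\<close> and \<open>B\<close> therefore give
  countably many closed sets \<open>C\<close> covering \<open>A\<close> and countably many closed sets \<open>D\<close> covering \<open>B\<close>, none
  of which contains any of these closures: by the Baire category theorem a meager subset of a
  perfect set in a completely metrizable space is not the whole of it
  (\<open>countably_perfectly_meager_in_closed_cover\<close>). The products \<open>C \<times> D\<close> cover
  \<open>A \<times> B\<close>, and each of them is nowhere dense in every \<open>P\<close> of the sequence: if \<open>C \<times> D\<close> contained
  the part of \<open>P\<close> in some rectangle meeting \<open>P\<close>, it would contain the part in a smaller one with a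
  perfect projection closure, and then \<open>C\<close> or \<open>D\<close> would contain that closure.
\<close>

section \<open>Countable bases\<close>

lemma separable_metrizable_imp_second_countable:
  assumes "separable_space X" "metrizable_space X"
  shows "second_countable X"
proof -
  obtain M d where "Metric_space M d" and X: "X = Metric_space.mtopology M d"
    using assms(2) unfolding metrizable_space_def by blast
  then interpret Metric_space M d by blast
  obtain S where S: "countable S" "S \<subseteq> M" "mtopology closure_of S = M"
    using assms(1) unfolding separable_space_def X by auto
  let ?\<B> = "(\<lambda>(c, n). mball c (inverse (real (Suc n)))) ` (S \<times> UNIV)"
  have "\<exists>V\<in>?\<B>. x \<in> V \<and> V \<subseteq> U" if "openin mtopology U" "x \<in> U" for U x
  proof -
    obtain r where r: "r > 0" "mball x r \<subseteq> U" and xM: "x \<in> M"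
      using \<open>openin mtopology U\<close> \<open>x \<in> U\<close> unfolding openin_mtopology by blast
    obtain n where n: "inverse (real (Suc n)) < r / 2"
      using reals_Archimedean[of "r / 2"] r by auto
    let ?e = "inverse (real (Suc n))"
    have "?e > 0" by simp
    moreover have "x \<in> mtopology closure_of S"
      using S xM by simp
    ultimately obtain c where c: "c \<in> S" "c \<in> mball x ?e"
      unfolding metric_closure_of by blast
    have "x \<in> mball c ?e"
      using c xM S by (auto simp: commute)
    moreover have "mball c ?e \<subseteq> mball x r"
    proof
      fix y assume y: "y \<in> mball c ?e"
      then have "d x y \<le> d x c + d c y"
        using c xM by (intro triangle) auto
      then show "y \<in> mball x r"
        using y c n xM by auto
    qed
    ultimately show ?thesis
      using r c by (intro bexI[of _ "mball c ?e"]) auto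
  qed
  moreover have "countable ?\<B>"
    using S by auto
  moreover have "\<forall>V\<in>?\<B>. openin mtopology V"
    by auto
  ultimately show ?thesis
    unfolding second_countable_def X by blast
qed

section \<open>Perfect sets and Baire category\<close>

lemma perfect_in_not_subset_meager:
  assumes X: "completely_metrizable_space X" and P: "perfect_in X P"
    and F: "meager_in (subtopology X P) (F \<inter> P)"
  shows "\<not> P \<subseteq> F"
proof
  assume "P \<subseteq> F"
  let ?Z = "subtopology X P"
  have PX: "P \<noteq> {}" "closedin X P" "topspace ?Z = P"
    using P closedin_subset by (auto simp: perfect_in_def)
  obtain \<N> where \<N>: "countable \<N>" "\<And>N. N \<in> \<N> \<Longrightarrow> nowhere_dense_in ?Z N" "\<Union>\<N> = P"
    using F \<open>P \<subseteq> F\<close> unfolding meager_in_def union_of_def by (auto simp: Int_absorb1)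
  let ?\<C> = "(\<lambda>N. ?Z closure_of N) ` \<N>"
  have "completely_metrizable_space ?Z"
    using X PX completely_metrizable_space_closedin by blast
  then have "?Z interior_of (\<Union>?\<C>) = {}"
    using \<N> by (intro Baire_category_alt) (auto simp: nowhere_dense_in_def)
  moreover have "N \<subseteq> ?Z closure_of N" if "N \<in> \<N>" for N
    using \<N>(2)[OF that] by (simp add: nowhere_dense_in_def closure_of_subset)
  then have "P \<subseteq> \<Union>?\<C>"
    using \<N>(3) by blast
  then have "P \<subseteq> ?Z interior_of (\<Union>?\<C>)"
    using PX by (metis interior_of_maximal openin_topspace)
  ultimately show False
    using PX by blast
qed

text \<open>
  This is the form in which the hypotheses enter: the pieces \<open>C\<close> are closed sets whose union is an
  \<open>F\<^sub>\<sigma>\<close>-set witnessing that \<open>A\<close> is countably perfectly meager, and by Baire even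
  that union contains no member of the family. The empty family cannot be enumerated by a sequence
  of perfect sets; it does arise, since no projection to \<open>X\<close> has a perfect closure when all the given
  perfect subsets of the product lie in vertical lines.
\<close>
lemma countably_perfectly_meager_in_closed_cover:
  assumes X: "completely_metrizable_space X" and A: "countably_perfectly_meager_in X A"
    and \<P>: "countable \<P>" "\<And>P. P \<in> \<P> \<Longrightarrow> perfect_in X P"
  obtains \<C> where "countable \<C>" "\<And>C. C \<in> \<C> \<Longrightarrow> closedin X C" "A \<subseteq> \<Union>\<C>"
    "\<And>C P. C \<in> \<C> \<Longrightarrow> P \<in> \<P> \<Longrightarrow> \<not> P \<subseteq> C"
proof (cases "\<P> = {}")
  case True
  show ?thesis
  proof
    show "countable {topspace X}"
      by simp
    show "A \<subseteq> \<Union>{topspace X}"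
      using A by (simp add: countably_perfectly_meager_in_def)
  qed (use True in auto)
next
  case False
  then have range: "range (from_nat_into \<P>) = \<P>"
    using \<P>(1) by (rule range_from_nat_into)
  then have "\<forall>n. perfect_in X (from_nat_into \<P> n)"
    using \<P>(2) by blast
  then obtain F where F: "fsigma_in X F" "A \<subseteq> F"
    "\<And>n. meager_in (subtopology X (from_nat_into \<P> n)) (F \<inter> from_nat_into \<P> n)"
    using A unfolding countably_perfectly_meager_in_def by blast
  obtain \<C> where \<C>: "countable \<C>" "\<And>C. C \<in> \<C> \<Longrightarrow> closedin X C" "\<Union>\<C> = F"
    using F(1) unfolding fsigma_in_def union_of_def by auto
  have "\<not> P \<subseteq> F" if "P \<in> \<P>" for P
  proof -
    have "P \<in> range (from_nat_into \<P>)"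
      using that by (simp only: range)
    then obtain n where "P = from_nat_into \<P> n"
      by (rule rangeE)
    then show ?thesis
      using perfect_in_not_subset_meager[OF X \<P>(2)[OF that]] F(3)[of n] by simp
  qed
  then have "\<not> P \<subseteq> C" if "C \<in> \<C>" "P \<in> \<P>" for C P
    using that \<C>(3) by (meson Union_upper order_trans)
  moreover have "A \<subseteq> \<Union>\<C>"
    using F(2) \<C>(3) by simp
  ultimately show ?thesis
    using that[OF \<C>(1,2)] by simp
qed

section \<open>Projections of perfect sets\<close>

text \<open>
  An isolated point of the closure already belongs to the set, because the neighbourhood isolating
  it meets the set.
\<close>
lemma closure_perfect_in_or_isolated_point:
  assumes "S \<subseteq> topspace X" "S \<noteq> {}"
  obtains "perfect_in X (X closure_of S)"
    | G x where "openin X G" "G \<inter> S = {x}"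
proof (cases "no_isolated_points (subtopology X (X closure_of S))")
  case True
  have "X closure_of S \<noteq> {}"
    using assms closure_of_subset by fastforce
  then show ?thesis
    using True that(1) by (simp add: perfect_in_def)
next
  case False
  then obtain x G where G: "openin X G" "{x} = G \<inter> X closure_of S"
    unfolding no_isolated_points_def openin_subtopology by blast
  then have "x \<in> X closure_of S" "x \<in> G"
    by auto
  then have "G \<inter> S \<noteq> {}"
    using G(1) unfolding in_closure_of by blast
  moreover have "G \<inter> S \<subseteq> {x}"
    using G(2) closure_of_subset[OF assms(1)] by blast
  ultimately have "G \<inter> S = {x}"
    by blast
  then show ?thesis
    using that(2) G(1) by blast
qed

text \<open>
  If a relatively open part of a perfect set lies in a vertical line, an isolated point of its
  projection to that line would be an isolated point of the perfect set.
\<close>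
lemma perfect_in_closure_snd_of_vertical_section:
  assumes P: "perfect_in (prod_topology X Y) P"
    and U: "openin X U" and V: "openin Y V"
    and ne: "P \<inter> U \<times> V \<noteq> {}" and line: "fst ` (P \<inter> U \<times> V) \<subseteq> {x}"
  shows "perfect_in Y (Y closure_of (snd ` (P \<inter> U \<times> V)))"
proof -
  let ?S = "snd ` (P \<inter> U \<times> V)"
  have "?S \<subseteq> topspace Y" "?S \<noteq> {}"
    using openin_subset[OF V] ne by auto
  then show ?thesis
  proof (cases rule: closure_perfect_in_or_isolated_point)
    case 1
    then show ?thesis .
  next
    case (2 G y)
    have "y \<in> ?S"
      using 2 by blast
    have *: "P \<inter> U \<times> (V \<inter> G) = {(x, y)}"
    proof
      show "P \<inter> U \<times> (V \<inter> G) \<subseteq> {(x, y)}"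
        using 2 line by force
      obtain z where "z \<in> P \<inter> U \<times> V" "snd z = y"
        using \<open>y \<in> ?S\<close> by blast
      moreover from this have "fst z = x"
        using line by blast
      ultimately show "{(x, y)} \<subseteq> P \<inter> U \<times> (V \<inter> G)"
        using 2 by (cases z) auto
    qed
    have "openin (prod_topology X Y) (U \<times> (V \<inter> G))"
      using U V 2 by (simp add: openin_prod_Times_iff openin_Int)
    then have "openin (subtopology (prod_topology X Y) P) {(x, y)}"
      using * unfolding openin_subtopology by (metis inf_commute)
    moreover from this have "(x, y) \<in> topspace (subtopology (prod_topology X Y) P)"
      using openin_subset by fastforce
    ultimately show ?thesis
      using P unfolding perfect_in_def no_isolated_points_def by blast
  qed
qed

text \<open>
  If the first projection fails to have a perfect closure, an isolated point of it confines a piece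
  of \<open>P\<close> to a vertical line, and then the second projection succeeds. Only \<open>U\<close> has to
  shrink for this, and choosing \<open>U'\<close> in the base keeps the family of projections countable.
\<close>
lemma perfect_projection_of_smaller_rectangle:
  assumes P: "perfect_in (prod_topology X Y) P"
    and \<U>: "\<And>U. U \<in> \<U> \<Longrightarrow> openin X U"
      "\<And>G x. openin X G \<Longrightarrow> x \<in> G \<Longrightarrow> \<exists>U\<in>\<U>. x \<in> U \<and> U \<subseteq> G"
    and U: "U \<in> \<U>" and V: "openin Y V" and ne: "P \<inter> U \<times> V \<noteq> {}"
  obtains U' where "U' \<in> \<U>" "U' \<subseteq> U"
    "perfect_in X (X closure_of (fst ` (P \<inter> U' \<times> V))) \<or>
     perfect_in Y (Y closure_of (snd ` (P \<inter> U' \<times> V)))"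
proof -
  let ?S = "fst ` (P \<inter> U \<times> V)"
  have "?S \<subseteq> topspace X" "?S \<noteq> {}"
    using openin_subset[OF \<U>(1)[OF U]] ne by auto
  then show ?thesis
  proof (cases rule: closure_perfect_in_or_isolated_point)
    case 1
    then show ?thesis
      using that U by blast
  next
    case (2 G x)
    then obtain y where y: "(x, y) \<in> P" "x \<in> U" "x \<in> G" "y \<in> V"
      by force
    have "openin X (U \<inter> G)"
      using \<U>(1) U 2 by blast
    then obtain U' where U': "U' \<in> \<U>" "x \<in> U'" "U' \<subseteq> U \<inter> G"
      using \<U>(2) y by (metis IntI)
    have "P \<inter> U' \<times> V \<noteq> {}" "fst ` (P \<inter> U' \<times> V) \<subseteq> {x}"
      using y U' 2 by (blast, force)
    then have "perfect_in Y (Y closure_of (snd ` (P \<inter> U' \<times> V)))"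
      using P \<U>(1) U' V by (intro perfect_in_closure_snd_of_vertical_section)
    then show ?thesis
      using that U' by blast
  qed
qed

section \<open>Products of countably perfectly meager sets\<close>

theorem theorem3p2:
  fixes X :: "'a topology" and Y :: "'b topology"
    and A :: "'a set" and B :: "'b set"
  assumes "perfect_Polish_space X" and "perfect_Polish_space Y"
    and "countably_perfectly_meager_in X A"
    and "countably_perfectly_meager_in Y B"
  shows "countably_perfectly_meager_in (prod_topology X Y) (A \<times> B)"
  unfolding countably_perfectly_meager_in_def
proof (intro conjI allI impI)
  show "A \<times> B \<subseteq> topspace (prod_topology X Y)"
    using assms(3,4) by (auto simp: countably_perfectly_meager_in_def)
next
  let ?Z = "prod_topology X Y"
  fix P :: "nat \<Rightarrow> ('a \<times> 'b) set"
  assume P: "\<forall>n. perfect_in ?Z (P n)"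
  have X: "completely_metrizable_space X" "second_countable X"
    and Y: "completely_metrizable_space Y" "second_countable Y"
    using assms(1,2) separable_metrizable_imp_second_countable
      completely_metrizable_imp_metrizable_space
    by (auto simp: perfect_Polish_space_def)
  obtain \<U> where \<U>: "countable \<U>" "\<And>U. U \<in> \<U> \<Longrightarrow> openin X U"
    "\<And>G x. openin X G \<Longrightarrow> x \<in> G \<Longrightarrow> \<exists>U\<in>\<U>. x \<in> U \<and> U \<subseteq> G"
    using X(2) unfolding second_countable_def by metis
  obtain \<V> where \<V>: "countable \<V>" "\<And>V. V \<in> \<V> \<Longrightarrow> openin Y V"
    "\<And>G y. openin Y G \<Longrightarrow> y \<in> G \<Longrightarrow> \<exists>V\<in>\<V>. y \<in> V \<and> V \<subseteq> G"
    using Y(2) unfolding second_countable_def by metis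
  define KX where "KX n U V = X closure_of (fst ` (P n \<inter> U \<times> V))" for n U V
  define KY where "KY n U V = Y closure_of (snd ` (P n \<inter> U \<times> V))" for n U V
  define \<K> where "\<K> = {K \<in> (\<lambda>(n, U, V). KX n U V) ` (UNIV \<times> \<U> \<times> \<V>). perfect_in X K}"
  define \<L> where "\<L> = {L \<in> (\<lambda>(n, U, V). KY n U V) ` (UNIV \<times> \<U> \<times> \<V>). perfect_in Y L}"
  have "countable \<K>" "countable \<L>"
    using \<U>(1) \<V>(1) unfolding \<K>_def \<L>_def by auto
  obtain \<C> where \<C>: "countable \<C>" "\<And>C. C \<in> \<C> \<Longrightarrow> closedin X C" "A \<subseteq> \<Union>\<C>"
    "\<And>C K. C \<in> \<C> \<Longrightarrow> K \<in> \<K> \<Longrightarrow> \<not> K \<subseteq> C"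
    using countably_perfectly_meager_in_closed_cover[OF X(1) assms(3) \<open>countable \<K>\<close>]
    unfolding \<K>_def by blast
  obtain \<D> where \<D>: "countable \<D>" "\<And>D. D \<in> \<D> \<Longrightarrow> closedin Y D" "B \<subseteq> \<Union>\<D>"
    "\<And>D L. D \<in> \<D> \<Longrightarrow> L \<in> \<L> \<Longrightarrow> \<not> L \<subseteq> D"
    using countably_perfectly_meager_in_closed_cover[OF Y(1) assms(4) \<open>countable \<L>\<close>]
    unfolding \<L>_def by blast
  define \<E> where "\<E> = (\<lambda>(C, D). C \<times> D) ` (\<C> \<times> \<D>)"
  have \<E>: "countable \<E>" "\<And>E. E \<in> \<E> \<Longrightarrow> closedin ?Z E"
    using \<C>(1,2) \<D>(1,2) unfolding \<E>_def by (auto simp: closedin_prod_Times_iff)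

  have no_rectangle: "\<not> P n \<inter> U \<times> V \<subseteq> C \<times> D"
    if "U \<in> \<U>" "V \<in> \<V>" "P n \<inter> U \<times> V \<noteq> {}" "C \<in> \<C>" "D \<in> \<D>" for n U V C D
  proof
    assume sub: "P n \<inter> U \<times> V \<subseteq> C \<times> D"
    obtain U' where U': "U' \<in> \<U>" "U' \<subseteq> U" "perfect_in X (KX n U' V) \<or> perfect_in Y (KY n U' V)"
      using perfect_projection_of_smaller_rectangle
        [OF P[rule_format] \<U>(2,3) \<open>U \<in> \<U>\<close> \<V>(2)[OF \<open>V \<in> \<V>\<close>] \<open>P n \<inter> U \<times> V \<noteq> {}\<close>]
      unfolding KX_def KY_def by blast
    have "fst ` (P n \<inter> U' \<times> V) \<subseteq> C" "snd ` (P n \<inter> U' \<times> V) \<subseteq> D"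
      using sub U'(2) by fastforce+
    then have "KX n U' V \<subseteq> C" "KY n U' V \<subseteq> D"
      using \<C>(2) \<D>(2) that unfolding KX_def KY_def by (simp_all add: closure_of_minimal)
    moreover have "KX n U' V \<in> \<K> \<or> KY n U' V \<in> \<L>"
      using U' that(2) unfolding \<K>_def \<L>_def by force
    ultimately show False
      using \<C>(4) \<D>(4) that by blast
  qed

  have nowhere_dense: "nowhere_dense_in (subtopology ?Z (P n)) (E \<inter> P n)" if "E \<in> \<E>" for n E
  proof -
    let ?Q = "subtopology ?Z (P n)"
    obtain C D where CD: "C \<in> \<C>" "D \<in> \<D>" "E = C \<times> D"
      using \<open>E \<in> \<E>\<close> unfolding \<E>_def by blast
    have "P n \<subseteq> topspace ?Z"
      using P closedin_subset unfolding perfect_in_def by blast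
    moreover have "closedin ?Q (E \<inter> P n)"
      using \<E>(2)[OF \<open>E \<in> \<E>\<close>] unfolding closedin_subtopology by blast
    moreover have "?Q interior_of (E \<inter> P n) = {}"
    proof (rule ccontr)
      assume "?Q interior_of (E \<inter> P n) \<noteq> {}"
      then obtain T z where T: "openin ?Z T" "T \<inter> P n \<subseteq> E" "z \<in> T \<inter> P n"
        unfolding interior_of_def openin_subtopology by blast
      then obtain U0 V0 where "openin X U0" "openin Y V0" "fst z \<in> U0" "snd z \<in> V0" "U0 \<times> V0 \<subseteq> T"
        unfolding openin_prod_topology_alt by (metis IntD1 prod.collapse)
      then obtain U V where UV: "U \<in> \<U>" "fst z \<in> U" "V \<in> \<V>" "snd z \<in> V" "U \<times> V \<subseteq> T"
        using \<U>(3)[of U0 "fst z"] \<V>(3)[of V0 "snd z"] by blast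
      then have "z \<in> P n \<inter> U \<times> V"
        using T(3) by (auto simp: mem_Times_iff)
      then show False
        using no_rectangle[of U V n C D] UV T(2) CD by blast
    qed
    ultimately show ?thesis
      unfolding nowhere_dense_in_def
      by (simp add: closure_of_closedin closedin_subset le_infI2)
  qed

  show "\<exists>F. fsigma_in ?Z F \<and> A \<times> B \<subseteq> F \<and> (\<forall>n. meager_in (subtopology ?Z (P n)) (F \<inter> P n))"
  proof (intro exI conjI allI)
    show "fsigma_in ?Z (\<Union>\<E>)"
      using \<E> unfolding fsigma_in_def union_of_def by blast
    show "A \<times> B \<subseteq> \<Union>\<E>"
      using \<C>(3) \<D>(3) unfolding \<E>_def by fastforce
    fix n
    have "countable ((\<lambda>E. E \<inter> P n) ` \<E>)" "\<Union>\<E> \<inter> P n = \<Union>((\<lambda>E. E \<inter> P n) ` \<E>)"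
      using \<E>(1) by auto
    then show "meager_in (subtopology ?Z (P n)) (\<Union>\<E> \<inter> P n)"
      using nowhere_dense unfolding meager_in_def union_of_def
      by (intro exI[of _ "(\<lambda>E. E \<inter> P n) ` \<E>"]) auto
  qed
qed

end
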